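(* Let $\varepsilon>0$ and $\lambda\ge0$ be fixed. Then there exists a number $\alpha_*=\alpha_*(\varepsilon,\lambda)>-1$ such that every solution $u$ of $$\frac1r\left(\frac{r u'}{\sqrt{1+\varepsilon^2(u')^2}}\right)'=\frac{\lambda}{(1+u)^2},\quad 0<r<1;\qquad u'(0)=u(1)=0,$$ satisfies $u(0)>\alpha_*$.
   Context: A solution is a classical one: $u\in C([0,1])\cap C^1([0,1))\cap C^2((0,1))$, with values $u(r)\in(-1,0]$, satisfying the differential equation on $(0,1)$ and the conditions $u'(0)=0$, $u(1)=0$. *)

theory Defs
  imports "HOL-Analysis.Analysis"
begin

text \<open>
  Here \<open>v\<close> is \<open>u'\<close> (one-sided at the endpoint 0) and \<open>w\<close> is \<open>u''\<close>. Their continuity expresses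
  \<open>u \<in> C\<^sup>1([0,1))\<close> and \<open>u \<in> C\<^sup>2((0,1))\<close>; only the values of \<open>u\<close> on \<open>[0,1]\<close> matter. The function
  under \<open>deriv\<close> is differentiable at each \<open>r \<in> (0,1)\<close> because \<open>v\<close> is.
\<close>

definition classical_solution :: "real \<Rightarrow> real \<Rightarrow> (real \<Rightarrow> real) \<Rightarrow> bool" where
  "classical_solution \<epsilon> lam u \<longleftrightarrow>
     continuous_on {0..1} u \<and>
     (\<forall>r\<in>{0..1}. u r \<in> {-1<..0}) \<and>
     (\<exists>v w.
        (\<forall>r\<in>{0..<1}. (u has_real_derivative v r) (at r within {0..<1})) \<and>
        continuous_on {0..<1} v \<and>
        (\<forall>r\<in>{0<..<1}. (v has_real_derivative w r) (at r)) \<and>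
        continuous_on {0<..<1} w \<and>
        (\<forall>r\<in>{0<..<1}.
           1 / r * deriv (\<lambda>s. s * v s / sqrt (1 + \<epsilon>\<^sup>2 * (v s)\<^sup>2)) r = lam / (1 + u r)\<^sup>2) \<and>
        v 0 = 0 \<and> u 1 = 0)"

end

theory Submission
  imports Defs
begin

text \<open>
  Write \<open>\<phi>(x) = x / sqrt(1 + \<epsilon>\<^sup>2x\<^sup>2)\<close> and \<open>a = 1 + u(0)\<close>. The equation \<open>(r \<phi>(u'))' = \<lambda>r / (1+u)\<^sup>2\<close>
  makes \<open>u\<close> nondecreasing, hence \<open>\<phi>(u')/r \<le> \<lambda>/(2a\<^sup>2)\<close>. The function
  \<open>H(x) = (1 - 1/sqrt(1 + \<epsilon>\<^sup>2x\<^sup>2)) / \<epsilon>\<^sup>2\<close> satisfies \<open>H' = x \<phi>'\<close>, so multiplying the equation by \<open>u'\<close>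
  shows that \<open>H(u') + \<lambda>/(1+u) + \<lambda>u/(2a\<^sup>2)\<close> is nondecreasing. If \<open>a \<le> 1/2\<close>, then \<open>1 + u\<close>
  takes the value \<open>4a/3\<close>; there \<open>H(u') \<ge> \<lambda>/(12a)\<close>, while \<open>H < 1/\<epsilon>\<^sup>2\<close>. Hence \<open>a > \<lambda>\<epsilon>\<^sup>2/12\<close>.
\<close>

definition flux :: "real \<Rightarrow> real \<Rightarrow> real" where
  "flux \<epsilon> x = x / sqrt (1 + \<epsilon>\<^sup>2 * x\<^sup>2)"

definition energy :: "real \<Rightarrow> real \<Rightarrow> real" where
  "energy \<epsilon> x = (1 - 1 / sqrt (1 + \<epsilon>\<^sup>2 * x\<^sup>2)) / \<epsilon>\<^sup>2"

lemma one_plus_square_pos [simp]: "0 < 1 + \<epsilon>\<^sup>2 * x\<^sup>2" for \<epsilon> x :: real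
  by (simp add: add_pos_nonneg)

lemma one_plus_square_nonzero [simp]: "1 + \<epsilon>\<^sup>2 * x\<^sup>2 \<noteq> 0" for \<epsilon> x :: real
  using one_plus_square_pos[of \<epsilon> x] by linarith

lemma sqrt_one_plus_square_has_derivative:
  "((\<lambda>x. sqrt (1 + \<epsilon>\<^sup>2 * x\<^sup>2)) has_real_derivative \<epsilon>\<^sup>2 * x / sqrt (1 + \<epsilon>\<^sup>2 * x\<^sup>2)) (at x)"
proof -
  have "((\<lambda>x. 1 + \<epsilon>\<^sup>2 * x\<^sup>2) has_real_derivative \<epsilon>\<^sup>2 * (2 * x)) (at x)"
    by (auto intro!: derivative_eq_intros)
  from DERIV_chain2[OF DERIV_real_sqrt[OF one_plus_square_pos] this] show ?thesis
    by (simp add: field_simps)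
qed

lemma flux_has_derivative:
  "(flux \<epsilon> has_real_derivative 1 / sqrt (1 + \<epsilon>\<^sup>2 * x\<^sup>2) ^ 3) (at x)"
proof -
  define q where "q = sqrt (1 + \<epsilon>\<^sup>2 * x\<^sup>2)"
  have q: "q > 0" "q\<^sup>2 = 1 + \<epsilon>\<^sup>2 * x\<^sup>2"
    unfolding q_def by (simp_all add: less_imp_le)
  have "(flux \<epsilon> has_real_derivative (1 * q - x * (\<epsilon>\<^sup>2 * x / q)) / (q * q)) (at x)"
    using q(1) DERIV_divide[OF DERIV_ident sqrt_one_plus_square_has_derivative]
    unfolding flux_def[abs_def] q_def by simp
  moreover have "(1 * q - x * (\<epsilon>\<^sup>2 * x / q)) / (q * q) = (q\<^sup>2 - \<epsilon>\<^sup>2 * x\<^sup>2) / q ^ 3"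
    using q(1) by (simp add: field_simps power2_eq_square power3_eq_cube)
  ultimately show ?thesis
    using q(2) by (simp add: q_def[symmetric])
qed

lemma energy_has_derivative:
  assumes "\<epsilon> \<noteq> 0"
  shows "(energy \<epsilon> has_real_derivative x / sqrt (1 + \<epsilon>\<^sup>2 * x\<^sup>2) ^ 3) (at x)"
proof -
  define q where "q = sqrt (1 + \<epsilon>\<^sup>2 * x\<^sup>2)"
  have q: "q > 0"
    unfolding q_def by simp
  have "(energy \<epsilon> has_real_derivative (0 - (0 * q - 1 * (\<epsilon>\<^sup>2 * x / q)) / (q * q)) / \<epsilon>\<^sup>2) (at x)"
    unfolding energy_def[abs_def] q_def
    by (intro DERIV_cdivide DERIV_diff DERIV_divide DERIV_const
        sqrt_one_plus_square_has_derivative) simp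
  moreover have "(0 - (0 * q - 1 * (\<epsilon>\<^sup>2 * x / q)) / (q * q)) / \<epsilon>\<^sup>2 = x / q ^ 3"
    using q assms by (simp add: field_simps power3_eq_cube)
  ultimately show ?thesis
    by (simp add: q_def)
qed

lemma energy_less: "\<epsilon> \<noteq> 0 \<Longrightarrow> energy \<epsilon> x < 1 / \<epsilon>\<^sup>2"
  unfolding energy_def by (intro divide_strict_right_mono) auto

lemma flux_nonneg_iff [simp]: "0 \<le> flux \<epsilon> x \<longleftrightarrow> 0 \<le> x"
  using one_plus_square_pos[of \<epsilon> x]
  by (auto simp: flux_def zero_le_divide_iff simp del: one_plus_square_pos)

lemma flux_nonpos_iff [simp]: "flux \<epsilon> x \<le> 0 \<longleftrightarrow> x \<le> 0"
  using one_plus_square_pos[of \<epsilon> x]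
  by (auto simp: flux_def divide_le_0_iff simp del: one_plus_square_pos)

text \<open>The half-open interval matches the regularity of a solution: \<open>u'\<close> is
  continuous up to 0 but need not extend to 1. Every comparison below starts at 0.\<close>

lemma nondecreasing_half_open:
  fixes f :: "real \<Rightarrow> real"
  assumes "continuous_on {0..<b} f"
    and "\<And>x. x \<in> {0<..<b} \<Longrightarrow> \<exists>d\<ge>0. (f has_real_derivative d) (at x)"
    and "0 \<le> r" "r < b"
  shows "f 0 \<le> f r"
proof (rule DERIV_nonneg_imp_increasing_open[OF \<open>0 \<le> r\<close>])
  show "\<exists>y. (f has_real_derivative y) (at x) \<and> 0 \<le> y" if "0 < x" "x < r" for x
    using assms(2)[of x] assms(4) that by auto
  show "continuous_on {0..r} f"
    using assms(4) by (intro continuous_on_subset[OF assms(1)]) auto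
qed

text \<open>The first alternative covers \<open>u 0 > -1/2\<close>, where the level used in the
  energy argument may fail to lie below the boundary value. The clause \<open>lam > 0\<close>
  excludes the second alternative when \<open>lam = 0\<close>, since there it would only give
  \<open>u 0 > -1\<close>.\<close>

lemma center_value_bound:
  fixes \<epsilon> lam :: real
  assumes eps: "\<epsilon> > 0" and lam: "lam \<ge> 0" and sol: "classical_solution \<epsilon> lam u"
  shows "1 / 2 < 1 + u 0 \<or> lam * \<epsilon>\<^sup>2 / 12 < 1 + u 0 \<and> lam > 0"
proof -
  have contu: "continuous_on {0..1} u" and range: "\<And>r. r \<in> {0..1} \<Longrightarrow> -1 < u r"
    and u1: "u 1 = 0"
    using sol unfolding classical_solution_def by auto
  have flux: "(\<lambda>s. s * flux \<epsilon> (v s)) = (\<lambda>s. s * v s / sqrt (1 + \<epsilon>\<^sup>2 * (v s)\<^sup>2))" for v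
    by (simp add: flux_def)
  obtain v w where
    du: "\<And>r. r \<in> {0..<1} \<Longrightarrow> (u has_real_derivative v r) (at r within {0..<1})" and
    contv: "continuous_on {0..<1} v" and
    dv: "\<And>r. r \<in> {0<..<1} \<Longrightarrow> (v has_real_derivative w r) (at r)" and
    eq: "\<And>r. r \<in> {0<..<1} \<Longrightarrow>
      1 / r * deriv (\<lambda>s. s * flux \<epsilon> (v s)) r = lam / (1 + u r)\<^sup>2" and
    v0: "v 0 = 0"
    using sol unfolding classical_solution_def flux[symmetric] by blast
  have contu': "continuous_on {0..<1} u"
    by (rule continuous_on_subset[OF contu]) auto
  have du': "(u has_real_derivative v r) (at r)" if "r \<in> {0<..<1}" for r
    using du[of r] that at_within_interior[of r "{0..<1}"] by auto
  \<comment> \<open>\<open>k r\<close> is the derivative of \<open>flux \<epsilon>\<close> at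
    \<open>v r\<close>.\<close>
  define k where "k = (\<lambda>r. 1 / sqrt (1 + \<epsilon>\<^sup>2 * (v r)\<^sup>2) ^ 3)"
  have dflux: "((\<lambda>s. s * flux \<epsilon> (v s)) has_real_derivative
      flux \<epsilon> (v r) + r * (k r * w r)) (at r)" if "r \<in> {0<..<1}" for r
    using DERIV_mult[OF DERIV_ident DERIV_chain2[OF flux_has_derivative dv[OF that]]]
    by (simp add: k_def algebra_simps)
  have ode: "flux \<epsilon> (v r) + r * (k r * w r) = lam * r / (1 + u r)\<^sup>2" if "r \<in> {0<..<1}" for r
    using eq[OF that] that DERIV_imp_deriv[OF dflux[OF that]]
    by (simp add: field_simps)
  have contflux: "continuous_on {0..<1} (\<lambda>s. s * flux \<epsilon> (v s))"
    unfolding flux_def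
    by (intro continuous_intros contv) auto

  have vnonneg: "0 \<le> v r" if "r \<in> {0..<1}" for r
  proof (cases "r = 0")
    case False
    \<comment> \<open>\<open>s * flux \<epsilon> (v s)\<close> vanishes at 0 and has derivative
      \<open>lam * s / (1 + u s)\<^sup>2 \<ge> 0\<close>; \<open>flux\<close> preserves
      signs.\<close>
    have "0 * flux \<epsilon> (v 0) \<le> r * flux \<epsilon> (v r)"
    proof (rule nondecreasing_half_open[OF contflux])
      show "\<exists>d\<ge>0. ((\<lambda>s. s * flux \<epsilon> (v s)) has_real_derivative d) (at x)" if "x \<in> {0<..<1}" for x
        using dflux[OF that] ode[OF that] that lam
        by (intro exI[of _ "lam * x / (1 + u x)\<^sup>2"]) auto
    qed (use that in auto)
    then show ?thesis
      using that False by (simp add: zero_le_mult_iff)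
  qed (simp add: v0)
  have umono: "u 0 \<le> u r" if "r \<in> {0..<1}" for r
  proof (rule nondecreasing_half_open[OF contu'])
    show "\<exists>d\<ge>0. (u has_real_derivative d) (at x)" if "x \<in> {0<..<1}" for x
      using that du'[OF that] vnonneg[of x] by (intro exI[of _ "v x"]) auto
  qed (use that in auto)

  define a where "a = 1 + u 0"
  have a: "a > 0"
    using range[of 0] by (simp add: a_def)
  have fluxle: "flux \<epsilon> (v r) \<le> lam * r / (2 * a\<^sup>2)" if "r \<in> {0..<1}" for r
  proof (cases "r = 0")
    case False
    \<comment> \<open>Since \<open>1 + u \<ge> a\<close>, the derivative of
      \<open>r * flux \<epsilon> (v r)\<close> is at most \<open>lam * r / a\<^sup>2\<close>, which
      has the primitive \<open>lam * r\<^sup>2 / (2 * a\<^sup>2)\<close>.\<close>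
    have "lam * 0\<^sup>2 / (2 * a\<^sup>2) - 0 * flux \<epsilon> (v 0) \<le> lam * r\<^sup>2 / (2 * a\<^sup>2) - r * flux \<epsilon> (v r)"
    proof (rule nondecreasing_half_open)
      show "continuous_on {0..<1} (\<lambda>r. lam * r\<^sup>2 / (2 * a\<^sup>2) - r * flux \<epsilon> (v r))"
        using a by (intro continuous_intros contflux) auto
      fix x :: real assume x: "x \<in> {0<..<1}"
      have "((\<lambda>r. lam * r\<^sup>2 / (2 * a\<^sup>2)) has_real_derivative lam * x / a\<^sup>2) (at x)"
        using a by (auto intro!: derivative_eq_intros simp: field_simps eval_nat_numeral)
      from DERIV_diff[OF this dflux[OF x]] have
        "((\<lambda>r. lam * r\<^sup>2 / (2 * a\<^sup>2) - r * flux \<epsilon> (v r)) has_real_derivative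
          lam * x / a\<^sup>2 - lam * x / (1 + u x)\<^sup>2) (at x)"
        by (simp add: ode[OF x])
      moreover have "lam * x / (1 + u x)\<^sup>2 \<le> lam * x / a\<^sup>2"
      proof (rule divide_left_mono)
        show "a\<^sup>2 \<le> (1 + u x)\<^sup>2"
          using umono[of x] x a by (intro power_mono) (auto simp: a_def)
        show "0 < (1 + u x)\<^sup>2 * a\<^sup>2"
          using range[of x] x a by auto
      qed (use x lam in auto)
      ultimately show "\<exists>d\<ge>0. ((\<lambda>r. lam * r\<^sup>2 / (2 * a\<^sup>2) - r * flux \<epsilon> (v r))
          has_real_derivative d) (at x)"
        by (intro exI[of _ "lam * x / a\<^sup>2 - lam * x / (1 + u x)\<^sup>2"]) auto
    qed (use that in auto)
    then have "r * flux \<epsilon> (v r) \<le> r * (lam * r / (2 * a\<^sup>2))"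
      by (simp add: power2_eq_square mult_ac)
    then show ?thesis
      by (rule mult_left_le_imp_le) (use that False in auto)
  qed (simp add: v0 flux_def)

  \<comment> \<open>The linear term in \<open>u\<close> absorbs the damping term
    \<open>v * flux \<epsilon> v / r\<close> that the radial operator adds to the one-dimensional
    energy identity.\<close>
  define Q where "Q = (\<lambda>r. energy \<epsilon> (v r) + lam / (1 + u r) + lam * u r / (2 * a\<^sup>2))"
  have Qmono: "Q 0 \<le> Q r" if "r \<in> {0..<1}" for r
  proof (rule nondecreasing_half_open)
    have "1 + u s \<noteq> 0" if "s \<in> {0..<1}" for s
      using range[of s] that by auto
    then show "continuous_on {0..<1} Q"
      unfolding Q_def energy_def using eps a
      by (intro continuous_intros contv contu')
        auto
    fix x :: real assume x: "x \<in> {0<..<1}"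
    have ux: "1 + u x \<noteq> 0"
      using range[of x] x by auto
    have "((\<lambda>r. energy \<epsilon> (v r)) has_real_derivative v x * k x * w x) (at x)"
      using DERIV_chain2[OF energy_has_derivative dv[OF x]] eps by (simp add: k_def)
    moreover have "((\<lambda>r. lam / (1 + u r)) has_real_derivative - (lam * v x) / (1 + u x)\<^sup>2) (at x)"
      using ux by (auto intro!: derivative_eq_intros du'[OF x] simp: power2_eq_square)
    moreover have "((\<lambda>r. lam * u r / (2 * a\<^sup>2)) has_real_derivative lam * v x / (2 * a\<^sup>2)) (at x)"
      using a
      by (auto intro!: derivative_eq_intros du'[OF x] simp: field_simps eval_nat_numeral)
    ultimately have dQ: "(Q has_real_derivative
        v x * k x * w x + - (lam * v x) / (1 + u x)\<^sup>2 + lam * v x / (2 * a\<^sup>2)) (at x)"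
      unfolding Q_def by (intro DERIV_add)
    have kw: "k x * w x = lam / (1 + u x)\<^sup>2 - flux \<epsilon> (v x) / x"
      using ode[OF x] x ux by (simp add: field_simps)
    \<comment> \<open>The terms with \<open>(1 + u x)\<^sup>2\<close> cancel, which leaves a product
      of two nonnegative factors.\<close>
    have "v x * k x * w x + - (lam * v x) / (1 + u x)\<^sup>2 + lam * v x / (2 * a\<^sup>2)
        = v x * (lam / (2 * a\<^sup>2) - flux \<epsilon> (v x) / x)"
      unfolding mult.assoc kw by (simp add: algebra_simps)
    moreover have "flux \<epsilon> (v x) / x \<le> lam / (2 * a\<^sup>2)"
      using fluxle[of x] x by (simp add: divide_le_eq)
    ultimately show "\<exists>d\<ge>0. (Q has_real_derivative d) (at x)"
      using dQ vnonneg[of x] x by (metis atLeastLessThan_iff diff_ge_0_iff_ge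
          greaterThanLessThan_iff less_imp_le mult_nonneg_nonneg)
  qed (use that in auto)

  show ?thesis
  proof (cases "a > 1 / 2")
    case False
    \<comment> \<open>At a level \<open>1 + u = c * a\<close> the energy gain is
      \<open>lam * (c - 1) * (2 - c) / (2 * c * a)\<close>, positive for \<open>1 < c < 2\<close>.
      The choice \<open>c = 4/3\<close> gives \<open>lam / (12 * a)\<close>, and
      \<open>a \<le> 1/2\<close> keeps the level below \<open>1 + u 1 = 1\<close>.\<close>
    have "u 0 \<le> 4 * a / 3 - 1" "4 * a / 3 - 1 \<le> u 1"
      using False a u1 by (simp_all add: a_def field_simps)
    then obtain r where r: "0 \<le> r" "r \<le> 1" "u r = 4 * a / 3 - 1"
      using IVT'[of u 0 "4 * a / 3 - 1" 1] contu by auto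
    have r1: "r < 1"
      using r u1 False by (cases "r = 1") auto
    have "lam / a + lam * (a - 1) / (2 * a\<^sup>2)
        \<le> energy \<epsilon> (v r) + lam / (4 * a / 3) + lam * (4 * a / 3 - 1) / (2 * a\<^sup>2)"
      using Qmono[of r] r r1 by (simp add: Q_def v0 energy_def a_def)
    moreover have "lam / a + lam * (a - 1) / (2 * a\<^sup>2)
        - lam / (4 * a / 3) - lam * (4 * a / 3 - 1) / (2 * a\<^sup>2) = lam / (12 * a)"
      using a by (simp add: field_simps power2_eq_square)
    ultimately have "lam / (12 * a) < 1 / \<epsilon>\<^sup>2"
      using energy_less[of \<epsilon> "v r"] eps by linarith
    then have "lam * \<epsilon>\<^sup>2 / 12 < a"
      using a eps by (simp add: field_simps)
    moreover have "lam > 0"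
    proof (rule ccontr)
      assume "\<not> lam > 0"
      then have "lam = 0"
        using lam by simp
      then have v: "v s = 0" if "s \<in> {0..<1}" for s
        using fluxle[OF that] vnonneg[OF that] by simp
      \<comment> \<open>With \<open>v = 0\<close>, \<open>u\<close> is constant on
        \<open>[0,1)\<close>, so it cannot reach the level \<open>4 * a / 3\<close>, which differs
        from \<open>a\<close>.\<close>
      have "u r = u 0"
        using nondecreasing_half_open[of 1 "\<lambda>s. - u s" r] umono[of r] r r1 contu' du' v
        by (fastforce intro!: continuous_intros exI[of _ 0] derivative_eq_intros)
      then show False
        using r a by (simp add: a_def field_simps)
    qed
    ultimately show ?thesis
      by (simp add: a_def)
  qed (simp add: a_def)
qed

theorem corollary3p4p1:
  fixes \<epsilon> lam :: real
  assumes "\<epsilon> > 0" and "lam \<ge> 0"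
  shows "\<exists>\<alpha>::real. \<alpha> > -1 \<and> (\<forall>u. classical_solution \<epsilon> lam u \<longrightarrow> u 0 > \<alpha>)"
proof (cases "lam = 0")
  case True
  \<comment> \<open>Only the first alternative survives, whence the witness
    \<open>-1/2\<close>.\<close>
  then show ?thesis
    using center_value_bound[OF assms] by (intro exI[of _ "- 1 / 2"]) fastforce
next
  case False
  \<comment> \<open>The minimum lies below both lower bounds for \<open>1 + u 0\<close>, and it is
    positive because \<open>lam\<close> and \<open>\<epsilon>\<close> are.\<close>
  then show ?thesis
    using center_value_bound[OF assms] assms
    by (intro exI[of _ "min (1 / 2) (lam * \<epsilon>\<^sup>2 / 12) - 1"]) fastforce
qed

end
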